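(* Let $G=(V,E,\vec{c})$ be a capacitated undirected graph and $\vec{d}_1,\dots,\vec{d}_k$ supply vectors on $G$. For each $i$, let $w_i\in\arg\max_{v\in V}|\vec{d}_i(v)|$. Let $\theta=\max_{1\le i\le k}|\{v\in V:\vec{d}_i(v)<0\}|$. Then $(w_1,\dots,w_k)$ is a $\max\{\theta-1,1\}$-approximate solution of LoMuF, i.e. $$\lambda(G;\vec{d}_1\circ w_1,\dots,\vec{d}_k\circ w_k)\ge\frac{\lambda(G;\vec{d}_1,\dots,\vec{d}_k)}{\max\{\theta-1,1\}}.$$
   Context: Capacities are $\vec{c}\in\mathbb{R}_+^E$, and each edge has an arbitrary fixed orientation. A demand vector is $\vec{d}\in\mathbb{R}^V$ with zero sum. A flow $\vec{f}\in\mathbb{R}^E$, where negative values mean transport against the orientation, satisfies $\vec{d}$ if at every vertex $v$ the inflow minus outflow equals $\vec{d}(v)$. A family of flows is valid if for each edge the sum of absolute flow values is at most the capacity. $\lambda(G;\vec{d}_1,\dots,\vec{d}_k)$ for demand vectors is the maximum $\lambda\ge0$ such that some valid family $\vec{f}_1,\dots,\vec{f}_k$ has $\vec{f}_i$ satisfying $\lambda\vec{d}_i$ for each $i$. A supply vector is $\vec{d}\in\mathbb{R}_-^V$. For $v\in V$, $\vec{d}\circ v$ is the demand vector equal to $\vec{d}(u)$ for $u\neq v$ and to $-\sum_{w\ne v}\vec{d}(w)$ at $v$. LoMuF asks for $v_1,\dots,v_k\in V$ maximizing $\lambda(G;\vec{d}_1\circ v_1,\dots,\vec{d}_k\circ v_k)$.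 The optimum value is denoted $\lambda(G;\vec{d}_1,\dots,\vec{d}_k)$. *)

theory Defs
  imports "HOL-Analysis.Analysis"
begin

text \<open>
  An undirected edge \<open>e\<close> joins the vertices in \<open>ends G e\<close>; \<open>tail\<close> and \<open>head\<close> record its fixed
  (arbitrary) reference orientation. Since edges form a type of their own, parallel edges are
  possible; a simple graph is the case where \<open>ends G\<close> is injective with two-element values.
\<close>

record ('v, 'e) cap_graph =
  verts :: "'v set"
  edges :: "'e set"
  ends :: "'e \<Rightarrow> 'v set"
  tail :: "'e \<Rightarrow> 'v"
  head :: "'e \<Rightarrow> 'v"
  cap :: "'e \<Rightarrow> real"

locale capacitated_graph =
  fixes G :: "('v, 'e) cap_graph"
  assumes finite_verts: "finite (verts G)"
    and finite_edges: "finite (edges G)"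
    and ends_verts: "e \<in> edges G \<Longrightarrow> ends G e \<subseteq> verts G"
    and orientation: "e \<in> edges G \<Longrightarrow> ends G e = {tail G e, head G e}"
    and cap_nonneg: "e \<in> edges G \<Longrightarrow> 0 \<le> cap G e"

definition demand_vector :: "('v, 'e) cap_graph \<Rightarrow> ('v \<Rightarrow> real) \<Rightarrow> bool" where
  "demand_vector G d \<longleftrightarrow> (\<Sum>v\<in>verts G. d v) = 0"

definition supply_vector :: "('v, 'e) cap_graph \<Rightarrow> ('v \<Rightarrow> real) \<Rightarrow> bool" where
  "supply_vector G d \<longleftrightarrow> (\<forall>v\<in>verts G. d v \<le> 0)"

definition with_sink :: "('v, 'e) cap_graph \<Rightarrow> ('v \<Rightarrow> real) \<Rightarrow> 'v \<Rightarrow> 'v \<Rightarrow> real" where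
  "with_sink G d v = (\<lambda>u. if u = v then - (\<Sum>w\<in>verts G - {v}. d w) else d u)"

lemma (in capacitated_graph) demand_vector_with_sink:
  assumes "v \<in> verts G"
  shows "demand_vector G (with_sink G d v)"
  using assms finite_verts
  by (simp add: demand_vector_def with_sink_def sum.remove[of "verts G" v])

definition satisfies :: "('v, 'e) cap_graph \<Rightarrow> ('e \<Rightarrow> real) \<Rightarrow> ('v \<Rightarrow> real) \<Rightarrow> bool" where
  "satisfies G f d \<longleftrightarrow> (\<forall>v\<in>verts G.
     (\<Sum>e | e \<in> edges G \<and> head G e = v. f e) - (\<Sum>e | e \<in> edges G \<and> tail G e = v. f e) = d v)"

definition valid_flows :: "('v, 'e) cap_graph \<Rightarrow> nat \<Rightarrow> (nat \<Rightarrow> 'e \<Rightarrow> real) \<Rightarrow> bool" where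
  "valid_flows G k f \<longleftrightarrow> (\<forall>e\<in>edges G. (\<Sum>i=1..k. \<bar>f i e\<bar>) \<le> cap G e)"

definition feasible_value ::
  "('v, 'e) cap_graph \<Rightarrow> nat \<Rightarrow> (nat \<Rightarrow> 'v \<Rightarrow> real) \<Rightarrow> real \<Rightarrow> bool" where
  "feasible_value G k d r \<longleftrightarrow> 0 \<le> r \<and>
     (\<exists>f. valid_flows G k f \<and> (\<forall>i\<in>{1..k}. satisfies G (f i) (\<lambda>v. r * d i v)))"

text \<open>
  If all demands vanish, every \<open>r \<ge> 0\<close> is feasible and there is no real maximum; the value is
  then \<open>\<infinity>\<close>. A finite value is an attained maximum, see \<open>flow_value_attained\<close> below.
\<close>

definition flow_value :: "('v, 'e) cap_graph \<Rightarrow> nat \<Rightarrow> (nat \<Rightarrow> 'v \<Rightarrow> real) \<Rightarrow> ereal" where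
  "flow_value G k d = (SUP r\<in>{r. feasible_value G k d r}. ereal r)"

definition lomuf_value :: "('v, 'e) cap_graph \<Rightarrow> nat \<Rightarrow> (nat \<Rightarrow> 'v \<Rightarrow> real) \<Rightarrow> ereal" where
  "lomuf_value G k d =
     (SUP v\<in>{1..k} \<rightarrow>\<^sub>E verts G. flow_value G k (\<lambda>i. with_sink G (d i) (v i)))"

lemma (in capacitated_graph) feasible_value_0: "feasible_value G k d 0"
  unfolding feasible_value_def valid_flows_def satisfies_def
  by (intro conjI exI[of _ "\<lambda>_ _. 0"]) (auto simp: cap_nonneg)

lemma compact_PiE_UNIV:
  fixes A :: "'a \<Rightarrow> 'b::topological_space set"
  assumes "\<And>i. compact (A i)"
  shows "compact (Pi\<^sub>E UNIV A)"
  using assms compactin_PiE[of "\<lambda>_. euclidean" UNIV A]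
  by (simp add: euclidean_product_topology)

lemma (in capacitated_graph) flow_value_attained:
  assumes "flow_value G k d \<noteq> \<infinity>"
  shows "\<exists>r. feasible_value G k d r \<and> flow_value G k d = ereal r
           \<and> (\<forall>s. feasible_value G k d s \<longrightarrow> s \<le> r)"
proof -
  let ?S = "{r. feasible_value G k d r}"
  define K :: "(nat \<Rightarrow> 'e \<Rightarrow> real) set" where
    "K = Pi\<^sub>E UNIV (\<lambda>i. Pi\<^sub>E UNIV (\<lambda>e. if i \<in> {1..k} \<and> e \<in> edges G then {- cap G e..cap G e} else {0}))"
  have le: "ereal r \<le> flow_value G k d" if "r \<in> ?S" for r
    unfolding flow_value_def using that by (rule SUP_upper)
  have "0 \<le> flow_value G k d"
    using le[of 0] feasible_value_0 by (simp add: zero_ereal_def)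
  with assms obtain B where B: "flow_value G k d = ereal B"
    by (cases "flow_value G k d") auto
  have bound: "r \<le> B" if "r \<in> ?S" for r using le[OF that] B by simp
  define T where "T = ({0..B} \<times> K) \<inter>
    {p. (\<forall>e\<in>edges G. (\<Sum>i=1..k. \<bar>snd p i e\<bar>) \<le> cap G e) \<and>
        (\<forall>i\<in>{1..k}. \<forall>v\<in>verts G.
          (\<Sum>e | e \<in> edges G \<and> head G e = v. snd p i e) - (\<Sum>e | e \<in> edges G \<and> tail G e = v. snd p i e)
            = fst p * d i v)}"
  have cont: "continuous_on UNIV (\<lambda>p :: real \<times> (nat \<Rightarrow> 'e \<Rightarrow> real). snd p i e)" for i e
  proof -
    have "continuous_on UNIV (\<lambda>p :: real \<times> (nat \<Rightarrow> 'e \<Rightarrow> real). snd p)"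
      by (intro continuous_intros)
    then have "continuous_on UNIV (\<lambda>p :: real \<times> (nat \<Rightarrow> 'e \<Rightarrow> real). snd p i)"
      by (rule continuous_on_product_then_coordinatewise)
    then show ?thesis
      by (rule continuous_on_product_then_coordinatewise)
  qed
  have "compact K"
    unfolding K_def by (intro compact_PiE_UNIV) auto
  moreover have "closed {p :: real \<times> (nat \<Rightarrow> 'e \<Rightarrow> real). (\<Sum>i=1..k. \<bar>snd p i e\<bar>) \<le> cap G e}" for e
    by (intro closed_Collect_le continuous_on_sum continuous_on_rabs continuous_on_const cont)
  moreover have "closed {p :: real \<times> (nat \<Rightarrow> 'e \<Rightarrow> real).
      (\<Sum>e | e \<in> edges G \<and> head G e = v. snd p i e) - (\<Sum>e | e \<in> edges G \<and> tail G e = v. snd p i e)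
        = fst p * d i v}" for i v
    by (intro closed_Collect_eq continuous_on_diff continuous_on_sum continuous_on_mult
        continuous_on_fst continuous_on_id continuous_on_const cont)
  ultimately have "compact T"
    unfolding T_def Collect_conj_eq Collect_ball_eq
    by (intro compact_Int_closed compact_Times closed_Int closed_INT ballI) auto
  then have "compact (fst ` T)"
    by (intro compact_continuous_image continuous_intros)
  moreover have "fst ` T = ?S"
  proof (intro equalityI subsetI)
    fix r assume "r \<in> fst ` T"
    then show "r \<in> ?S"
      by (fastforce simp: T_def feasible_value_def valid_flows_def satisfies_def)
  next
    fix r assume r: "r \<in> ?S"
    then obtain f where f: "valid_flows G k f" "\<forall>i\<in>{1..k}. satisfies G (f i) (\<lambda>v. r * d i v)"
      and "0 \<le> r"
      by (auto simp: feasible_value_def)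
    define g where "g = (\<lambda>i e. if i \<in> {1..k} \<and> e \<in> edges G then f i e else 0)"
    have "\<bar>f i e\<bar> \<le> cap G e" if "i \<in> {1..k}" "e \<in> edges G" for i e
      using member_le_sum[of i "{1..k}" "\<lambda>i. \<bar>f i e\<bar>"] f(1) that
      by (force simp: valid_flows_def)
    then have "g \<in> K"
      by (fastforce simp: K_def g_def abs_le_iff PiE_UNIV_domain)
    moreover have "(\<Sum>i=1..k. \<bar>g i e\<bar>) \<le> cap G e" if "e \<in> edges G" for e
      using f(1) that by (simp add: g_def valid_flows_def)
    moreover have "(\<Sum>e | e \<in> edges G \<and> P e. g i e) = (\<Sum>e | e \<in> edges G \<and> P e. f i e)"
      if "i \<in> {1..k}" for i P
      using that by (intro sum.cong) (auto simp: g_def)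
    ultimately have "(r, g) \<in> T"
      using f(2) \<open>0 \<le> r\<close> bound[OF r] by (simp add: T_def satisfies_def)
    then show "r \<in> fst ` T" by force
  qed
  ultimately have "compact ?S" by simp
  moreover have "?S \<noteq> {}" using feasible_value_0 by blast
  ultimately obtain m where m: "m \<in> ?S" "\<forall>s\<in>?S. s \<le> m"
    using compact_attains_sup by metis
  then have "flow_value G k d = ereal m"
    unfolding flow_value_def by (intro antisym SUP_least SUP_upper) auto
  with m show ?thesis by auto
qed

end

theory Submission
  imports Defs
begin

text \<open>
  Fix one commodity, routed by a flow \<open>f\<close> to some sink \<open>v\<close>. Split off the part \<open>t\<close> of \<open>f\<close> that
  carries the supply of \<open>w\<close>, without cancellation against the remaining part. Dropping \<open>t\<close> and
  sending the supply of all vertices other than \<open>w\<close> from \<open>v\<close> to \<open>w\<close>, along a multiple of \<open>- t\<close>,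
  reroutes the commodity to \<open>w\<close>. As \<open>w\<close> has the largest supply, that multiple is at most \<open>\<theta> - 1\<close>,
  while the rest of \<open>f\<close> is used once.

  The splitting does not need path decompositions: let \<open>p u\<close> be the proportion of the throughput of
  \<open>u\<close> that originates at \<open>w\<close>. Perfect mixing at the vertices is a monotone fixed-point equation on
  \<open>[0,1]\<close>-valued functions, and any solution (even in the presence of cycles) yields a splitting.
\<close>

section \<open>Net inflow at the vertices\<close>

definition excess :: "('v, 'e) cap_graph \<Rightarrow> ('e \<Rightarrow> real) \<Rightarrow> 'v \<Rightarrow> real" where
  "excess G f v =
     (\<Sum>e | e \<in> edges G \<and> head G e = v. f e) - (\<Sum>e | e \<in> edges G \<and> tail G e = v. f e)"

lemma satisfies_iff_excess: "satisfies G f d \<longleftrightarrow> (\<forall>v\<in>verts G. excess G f v = d v)"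
  by (simp add: satisfies_def excess_def)

lemma excess_diff: "excess G (\<lambda>e. f e - g e) v = excess G f v - excess G g v"
  by (simp add: excess_def sum_subtractf)

lemma excess_mult: "excess G (\<lambda>e. c * f e) v = c * excess G f v"
  by (simp add: excess_def sum_distrib_left right_diff_distrib)

lemma (in capacitated_graph) tail_head_verts:
  assumes "e \<in> edges G"
  shows "tail G e \<in> verts G" "head G e \<in> verts G"
  using ends_verts[OF assms] orientation[OF assms] by auto

lemma (in capacitated_graph) sum_excess: "(\<Sum>v\<in>verts G. excess G f v) = 0"
proof -
  have "(\<Sum>v\<in>verts G. \<Sum>e | e \<in> edges G \<and> head G e = v. f e) = sum f (edges G)"
    using finite_verts finite_edges tail_head_verts by (intro sum.group) auto
  moreover have "(\<Sum>v\<in>verts G. \<Sum>e | e \<in> edges G \<and> tail G e = v. f e) = sum f (edges G)"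
    using finite_verts finite_edges tail_head_verts by (intro sum.group) auto
  ultimately show ?thesis
    by (simp add: excess_def sum_subtractf)
qed

section \<open>Perfect mixing and the splitting of a flow\<close>

text \<open>Knaster-Tarski on the lattice of \<open>[0,1]\<close>-valued functions: the pointwise
  supremum \<open>s\<close> of all \<open>q\<close> with \<open>q \<le> F q\<close> is the greatest
  fixed point.\<close>

lemma unit_interval_fixed_point:
  fixes F :: "('a \<Rightarrow> real) \<Rightarrow> 'a \<Rightarrow> real"
  assumes F01: "\<And>q u. range q \<subseteq> {0..1} \<Longrightarrow> F q u \<in> {0..1}"
    and mono: "\<And>q q' u. range q \<subseteq> {0..1} \<Longrightarrow> range q' \<subseteq> {0..1} \<Longrightarrow> (\<And>x. q x \<le> q' x) \<Longrightarrow> F q u \<le> F q' u"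
  obtains p where "range p \<subseteq> {0..1}" "\<And>u. F p u = p u"
proof -
  define P where "P = {q. range q \<subseteq> {0..1} \<and> (\<forall>u. q u \<le> F q u)}"
  define s where "s u = (SUP q\<in>P. q u)" for u
  have zero: "(\<lambda>_. 0) \<in> P"
    unfolding P_def using F01[of "\<lambda>_. 0"] by auto
  have bdd: "bdd_above ((\<lambda>q. q u) ` P)" for u
    by (rule bdd_aboveI[of _ 1]) (auto simp: P_def image_subset_iff)
  have upper: "q u \<le> s u" if "q \<in> P" for q u
    unfolding s_def using that bdd by (rule cSUP_upper)
  have least: "s u \<le> c" if "\<And>q. q \<in> P \<Longrightarrow> q u \<le> c" for u c
    unfolding s_def using zero that by (intro cSUP_least) auto
  have "s u \<le> 1" for u
    by (rule least) (auto simp: P_def image_subset_iff)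
  with upper[OF zero] have s01: "range s \<subseteq> {0..1}"
    by (simp add: image_subset_iff)
  have sF: "s u \<le> F s u" for u
  proof (rule least)
    fix q assume q: "q \<in> P"
    have "q u \<le> F q u" using q by (simp add: P_def)
    also have "\<dots> \<le> F s u" using q s01 upper[OF q] by (intro mono) (auto simp: P_def)
    finally show "q u \<le> F s u" .
  qed
  have "range (F s) \<subseteq> {0..1}" using F01[OF s01] by blast
  then have "F s \<in> P"
    unfolding P_def using mono[OF s01 _ sF] by simp
  then have "F s u \<le> s u" for u by (rule upper)
  with sF s01 show thesis by (intro that[of s] antisym)
qed

text \<open>On each edge \<open>t\<close> is the share of \<open>f\<close> given by the proportion
  \<open>p\<close> at the vertex the flow comes from. Such a share has the sign of \<open>f\<close>
  and at most its size, hence no cancellation. The mixing equation fixes the excess of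
  \<open>t\<close> away from \<open>v\<close>; at \<open>v\<close> it follows because all excesses
  sum to zero.\<close>

lemma (in capacitated_graph) split_off_supply:
  assumes f: "satisfies G f D"
    and nonpos: "\<And>u. u \<in> verts G - {v} \<Longrightarrow> D u \<le> 0"
    and v: "v \<in> verts G" and w: "w \<in> verts G" "w \<noteq> v"
  obtains t where "\<And>e. e \<in> edges G \<Longrightarrow> \<bar>t e\<bar> + \<bar>f e - t e\<bar> = \<bar>f e\<bar>"
    and "satisfies G t (\<lambda>u. if u = w then D w else if u = v then - D w else 0)"
proof -
  \<comment> \<open>The direction of transport decides which end is upstream: the tail for
    \<open>pos\<close>, the head for \<open>neg\<close>.\<close>
  define pos where "pos e = max (f e) 0" for e
  define neg where "neg e = max (- f e) 0" for e
  let ?H = "\<lambda>u. {e. e \<in> edges G \<and> head G e = u}" and ?T = "\<lambda>u. {e. e \<in> edges G \<and> tail G e = u}"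
  \<comment> \<open>If a proportion \<open>q x\<close> of the flow leaving each \<open>x\<close> is
    marked, \<open>In q u\<close> is the marked flow entering \<open>u\<close>; \<open>Out u\<close>
    is all flow leaving \<open>u\<close>.\<close>
  define In where "In q u =
    (\<Sum>e\<in>?H u. pos e * q (tail G e)) + (\<Sum>e\<in>?T u. neg e * q (head G e))" for q :: "'v \<Rightarrow> real" and u
  define Out where "Out u = (\<Sum>e\<in>?H u. neg e) + (\<Sum>e\<in>?T u. pos e)" for u
  define split where "split q e = pos e * q (tail G e) - neg e * q (head G e)" for q :: "'v \<Rightarrow> real" and e
  have pn: "0 \<le> pos e" "0 \<le> neg e" "f e = pos e - neg e" for e
    by (auto simp: pos_def neg_def)
  have In_mono: "In q u \<le> In q' u" if "\<And>x. q x \<le> q' x" for q q' u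
    unfolding In_def by (intro add_mono sum_mono mult_left_mono that pn)
  have In_nonneg: "0 \<le> In q u" if "\<And>x. 0 \<le> q x" for q u
    unfolding In_def by (intro add_nonneg_nonneg sum_nonneg mult_nonneg_nonneg that pn)
  have Out_nonneg: "0 \<le> Out u" for u
    unfolding Out_def by (intro add_nonneg_nonneg sum_nonneg pn)
  have excess_split: "excess G (split q) u = In q u - q u * Out u" for q u
    unfolding excess_def split_def In_def Out_def
    by (simp add: sum_subtractf sum_distrib_left algebra_simps)
  have Out: "Out u = In (\<lambda>_. 1) u - D u" if "u \<in> verts G" for u
  proof -
    have "split (\<lambda>_. 1) = f" by (auto simp: split_def pn(3))
    then show ?thesis
      using excess_split[of "\<lambda>_. 1" u] f that by (simp add: satisfies_iff_excess)
  qed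
  define src where "src u = (if u = w then - D w else 0)" for u
  have src: "0 \<le> src u" "u \<in> verts G - {v} \<Longrightarrow> src u \<le> - D u" for u
    using nonpos[of w] nonpos[of u] w by (auto simp: src_def)
  \<comment> \<open>Mixing: marked flow entering or starting at \<open>u\<close>, relative to all
    flow leaving it. The value 0 at \<open>v\<close> makes \<open>v\<close> absorb all marked flow,
    even if \<open>f\<close> passes through \<open>v\<close>.\<close>
  define F where "F q u = (if u \<in> verts G - {v} then (src u + In q u) / Out u else 0)" for q u
  \<comment> \<open>By conservation \<open>Out u\<close> is the full inflow plus the supply
    \<open>- D u\<close>; these dominate the marked inflow and \<open>src u\<close>.\<close>
  have le_Out: "src u + In q u \<le> Out u" if "u \<in> verts G - {v}" "\<And>x. q x \<le> 1" for q u
    using src(2)[OF that(1)] In_mono[of q "\<lambda>_. 1" u] Out[of u] that by auto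
  obtain p where p01: "range p \<subseteq> {0..1}" and p: "\<And>u. F p u = p u"
  proof (rule unit_interval_fixed_point[of F])
    fix q :: "'v \<Rightarrow> real" and u assume "range q \<subseteq> {0..1}"
    then have q: "0 \<le> q x" "q x \<le> 1" for x by (auto simp: image_subset_iff)
    show "F q u \<in> {0..1}"
      using le_Out[of u q] src[of u] In_nonneg[of q u] Out_nonneg[of u] q
      by (auto simp: F_def divide_le_eq_1)
  next
    fix q q' :: "'v \<Rightarrow> real" and u assume "\<And>x. q x \<le> q' x"
    then show "F q u \<le> F q' u"
      using In_mono[of q q' u] Out_nonneg[of u] by (auto simp: F_def intro!: divide_right_mono)
  qed blast
  have pr: "0 \<le> p x" "p x \<le> 1" for x using p01 by (auto simp: image_subset_iff)
  have ex: "excess G (split p) u = - src u" if u: "u \<in> verts G - {v}" for u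
  proof (cases "Out u = 0")
    \<comment> \<open>Division by zero makes \<open>p u = 0\<close> here. This is harmless: no flow
      leaves \<open>u\<close>, so by \<open>le_Out\<close> both \<open>src u\<close> and
      \<open>In p u\<close> vanish.\<close>
    case True
    with le_Out[OF u, of p] src(1)[of u] In_nonneg[of p u] pr show ?thesis
      by (simp add: excess_split)
  next
    case False
    then show ?thesis using p[of u] u by (simp add: excess_split F_def field_simps)
  qed
  have "excess G (split p) v = - (\<Sum>u\<in>verts G - {v}. excess G (split p) u)"
    using sum_excess[of "split p"] v finite_verts by (simp add: sum.remove[of _ v])
  also have "\<dots> = (\<Sum>u\<in>verts G - {v}. src u)"
    using ex by (simp add: sum_negf)
  also have "\<dots> = - D w"
    using w finite_verts by (simp add: src_def)
  finally have exv: "excess G (split p) v = - D w" .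
  show thesis
  proof (rule that[of "split p"])
    fix e
    have "p x * y \<le> y" "0 \<le> p x * y" if "0 \<le> y" for x y
      using pr[of x] that mult_right_mono[of "p x" 1 y] by auto
    from this[of "\<bar>f e\<bar>" "tail G e"] this[of "\<bar>f e\<bar>" "head G e"]
    show "\<bar>split p e\<bar> + \<bar>f e - split p e\<bar> = \<bar>f e\<bar>"
      by (cases "0 \<le> f e") (auto simp: split_def pos_def neg_def max_def abs_if mult.commute)
  next
    show "satisfies G (split p) (\<lambda>u. if u = w then D w else if u = v then - D w else 0)"
      using ex exv w by (auto simp: satisfies_iff_excess src_def)
  qed
qed

section \<open>Rerouting one commodity\<close>

lemma sum_ge_card_mult_min:
  fixes d :: "'a \<Rightarrow> real"
  assumes "finite A" "\<And>u. u \<in> A \<Longrightarrow> m \<le> d u" "\<And>u. u \<in> A \<Longrightarrow> d u \<le> 0"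
  shows "real (card {u \<in> A. d u < 0}) * m \<le> sum d A"
proof -
  have "d u = 0" if "u \<in> A" "\<not> d u < 0" for u
    using assms(3)[OF that(1)] that(2) by simp
  then have "sum d A = (\<Sum>u | u \<in> A \<and> d u < 0. d u)"
    using assms(1) by (intro sum.mono_neutral_right) auto
  then show ?thesis
    using sum_bounded_below[of "{u \<in> A. d u < 0}" m d] assms(2) by simp
qed

lemma (in capacitated_graph) reroute:
  assumes f: "satisfies G f (\<lambda>u. r * with_sink G d v u)"
    and r: "0 \<le> r" and v: "v \<in> verts G"
    and neg: "supply_vector G d"
    and w: "is_arg_max (\<lambda>u. \<bar>d u\<bar>) (\<lambda>u. u \<in> verts G) w"
    and M: "1 \<le> M" "real (card {u \<in> verts G. d u < 0}) - 1 \<le> M"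
  obtains g where "satisfies G g (\<lambda>u. r * with_sink G d w u)"
    and "\<And>e. e \<in> edges G \<Longrightarrow> \<bar>g e\<bar> \<le> M * \<bar>f e\<bar>"
proof -
  have wV: "w \<in> verts G" and max: "\<And>u. u \<in> verts G \<Longrightarrow> \<bar>d u\<bar> \<le> \<bar>d w\<bar>"
    using w by (auto simp: is_arg_max_linorder)
  have nonpos: "d u \<le> 0" if "u \<in> verts G" for u
    using neg that by (simp add: supply_vector_def)
  have min: "d w \<le> d u" if "u \<in> verts G" for u
    using max[OF that] nonpos[OF that] nonpos[OF wV] by simp
  consider "w = v" | "w \<noteq> v" "d w = 0" | "w \<noteq> v" "d w < 0"
    using nonpos[OF wV] by fastforce
  then show thesis
  proof cases
    case 1
    have "\<bar>f e\<bar> \<le> M * \<bar>f e\<bar>" for e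
      using mult_right_mono[OF M(1), of "\<bar>f e\<bar>"] by simp
    with f 1 show thesis by (intro that[of f]) auto
  next
    \<comment> \<open>The supply of \<open>w\<close> is the largest, so all supplies vanish and the
      zero flow suffices.\<close>
    case 2
    then have "d u = 0" if "u \<in> verts G" for u
      using min[OF that] nonpos[OF that] by simp
    then show thesis
      using M by (intro that[of "\<lambda>_. 0"]) (auto simp: satisfies_iff_excess excess_def with_sink_def)
  next
    case 3
    define S where "S = sum d (verts G)"
    have S: "sum d (verts G - {u}) = S - d u" if "u \<in> verts G" for u
      using that finite_verts by (simp add: S_def sum_diff1)
    obtain t where t: "\<And>e. e \<in> edges G \<Longrightarrow> \<bar>t e\<bar> + \<bar>f e - t e\<bar> = \<bar>f e\<bar>"
      and sat: "satisfies G t (\<lambda>u. if u = w then r * with_sink G d v w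
        else if u = v then - (r * with_sink G d v w) else 0)"
      using split_off_supply[OF f _ v wV 3(1)] nonpos r
      by (auto simp: with_sink_def mult_nonneg_nonpos)
    \<comment> \<open>\<open>c\<close> is the supply of the other vertices relative to that of
      \<open>w\<close>. Subtracting \<open>S / d w = 1 + c\<close> copies of \<open>t\<close>
      removes \<open>t\<close> and sends \<open>c\<close> further copies back from \<open>v\<close>
      to \<open>w\<close>.\<close>
    define c where "c = S / d w - 1"
    have "S \<le> d w"
      using S[OF wV] sum_nonpos[of "verts G - {w}" d] nonpos by auto
    then have "0 \<le> c" using 3 by (simp add: c_def field_simps)
    have "S / d w \<le> real (card {u \<in> verts G. d u < 0})"
      using sum_ge_card_mult_min[OF finite_verts min nonpos] 3 by (simp add: S_def divide_le_eq)
    then have "c \<le> M" using M by (simp add: c_def)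
    show thesis
    proof (rule that[of "\<lambda>e. f e - S / d w * t e"])
      show "satisfies G (\<lambda>e. f e - S / d w * t e) (\<lambda>u. r * with_sink G d w u)"
        unfolding satisfies_iff_excess
      proof
        fix u assume u: "u \<in> verts G"
        \<comment> \<open>Up to the factor \<open>r\<close>, \<open>f\<close> has the surplus term
          \<open>- S\<close> at \<open>v\<close>, and so do \<open>S / d w\<close> copies of
          \<open>t\<close>; the difference leaves just \<open>d v\<close>.\<close>
        have "excess G f u = r * (if u = v then d v - S else d u)"
          using f u S[OF v] by (simp add: satisfies_iff_excess with_sink_def)
        moreover have "excess G t u = r * (if u = w then d w else if u = v then - d w else 0)"
          using sat u 3 by (simp add: satisfies_iff_excess with_sink_def)
        ultimately have "excess G (\<lambda>e. f e - S / d w * t e) u =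
            r * (if u = v then d v - S else d u)
              - S / d w * (r * (if u = w then d w else if u = v then - d w else 0))"
          by (simp only: excess_diff excess_mult)
        also have "\<dots> = r * with_sink G d w u"
          using S[OF u] 3 by (auto simp: with_sink_def right_diff_distrib)
        finally show "excess G (\<lambda>e. f e - S / d w * t e) u = r * with_sink G d w u" .
      qed
    next
      fix e assume e: "e \<in> edges G"
      \<comment> \<open>The weights 1 of \<open>f - t\<close> and \<open>c\<close> of
        \<open>t\<close> are both at most \<open>M\<close>, and without cancellation the two
        absolute values recombine to that of \<open>f e\<close>.\<close>
      have "\<bar>f e - S / d w * t e\<bar> = \<bar>(f e - t e) - c * t e\<bar>"
        by (simp add: c_def algebra_simps)
      also have "\<dots> \<le> 1 * \<bar>f e - t e\<bar> + c * \<bar>t e\<bar>"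
        using abs_triangle_ineq4[of "f e - t e" "c * t e"] \<open>0 \<le> c\<close> by (simp add: abs_mult)
      also have "\<dots> \<le> M * \<bar>f e - t e\<bar> + M * \<bar>t e\<bar>"
        using M(1) \<open>c \<le> M\<close> by (intro add_mono mult_right_mono) auto
      also have "\<dots> = M * \<bar>f e\<bar>"
        using t[OF e, symmetric] by (simp add: algebra_simps)
      finally show "\<bar>f e - S / d w * t e\<bar> \<le> M * \<bar>f e\<bar>" .
    qed
  qed
qed

section \<open>All commodities and the approximation ratio\<close>

text \<open>Rerouting inflates each flow on each edge by at most the common factor \<open>M\<close>;
  scaling by \<open>1 / M\<close> restores validity and turns \<open>r\<close> into
  \<open>r / M\<close>.\<close>

lemma (in capacitated_graph) feasible_value_reroute:
  assumes feas: "feasible_value G k (\<lambda>i. with_sink G (d i) (v i)) r"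
    and v: "\<And>i. i \<in> {1..k} \<Longrightarrow> v i \<in> verts G"
    and neg: "\<And>i. i \<in> {1..k} \<Longrightarrow> supply_vector G (d i)"
    and w: "\<And>i. i \<in> {1..k} \<Longrightarrow> is_arg_max (\<lambda>u. \<bar>d i u\<bar>) (\<lambda>u. u \<in> verts G) (w i)"
    and M: "1 \<le> M" "\<And>i. i \<in> {1..k} \<Longrightarrow> real (card {u \<in> verts G. d i u < 0}) - 1 \<le> M"
  shows "feasible_value G k (\<lambda>i. with_sink G (d i) (w i)) (r / M)"
proof -
  obtain f where r: "0 \<le> r" and valid: "valid_flows G k f"
    and f: "\<And>i. i \<in> {1..k} \<Longrightarrow> satisfies G (f i) (\<lambda>u. r * with_sink G (d i) (v i) u)"
    using feas by (auto simp: feasible_value_def)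
  have "\<exists>g. satisfies G g (\<lambda>u. r * with_sink G (d i) (w i) u) \<and>
      (\<forall>e\<in>edges G. \<bar>g e\<bar> \<le> M * \<bar>f i e\<bar>)" if i: "i \<in> {1..k}" for i
    by (rule reroute[OF f[OF i] r v[OF i] neg[OF i] w[OF i] M(1) M(2)[OF i]]) blast
  then obtain g where
    g: "\<And>i. i \<in> {1..k} \<Longrightarrow> satisfies G (g i) (\<lambda>u. r * with_sink G (d i) (w i) u)"
    and le: "\<And>i e. i \<in> {1..k} \<Longrightarrow> e \<in> edges G \<Longrightarrow> \<bar>g i e\<bar> \<le> M * \<bar>f i e\<bar>"
    by metis
  define h where "h i e = 1 / M * g i e" for i e
  have "\<bar>h i e\<bar> \<le> \<bar>f i e\<bar>" if "i \<in> {1..k}" "e \<in> edges G" for i e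
    using le[OF that] M(1) by (simp add: h_def abs_mult divide_le_eq mult.commute)
  then have "(\<Sum>i=1..k. \<bar>h i e\<bar>) \<le> (\<Sum>i=1..k. \<bar>f i e\<bar>)" if "e \<in> edges G" for e
    using that by (intro sum_mono) auto
  then have "valid_flows G k h"
    using valid unfolding valid_flows_def by (meson order_trans)
  moreover have "satisfies G (h i) (\<lambda>u. r / M * with_sink G (d i) (w i) u)" if "i \<in> {1..k}" for i
    using g[OF that] unfolding h_def satisfies_iff_excess excess_mult by simp
  ultimately show ?thesis
    using r M(1) unfolding feasible_value_def by auto
qed

theorem theorem3:
  fixes G :: "('v, 'e) cap_graph"
    and k \<theta> :: nat
    and d :: "nat \<Rightarrow> 'v \<Rightarrow> real"
    and w :: "nat \<Rightarrow> 'v"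
  assumes "capacitated_graph G"
    and "k \<ge> 1"
    and "\<And>i. i \<in> {1..k} \<Longrightarrow> supply_vector G (d i)"
    and "\<And>i. i \<in> {1..k} \<Longrightarrow> is_arg_max (\<lambda>v. \<bar>d i v\<bar>) (\<lambda>v. v \<in> verts G) (w i)"
    and "\<theta> = Max ((\<lambda>i. card {v \<in> verts G. d i v < 0}) ` {1..k})"
  shows "flow_value G k (\<lambda>i. with_sink G (d i) (w i))
           \<ge> lomuf_value G k d / ereal (max (real \<theta> - 1) 1)"
proof -
  interpret capacitated_graph G by fact
  \<comment> \<open>The 1 pays for the part of \<open>f\<close> that is kept,
    \<open>\<theta> - 1\<close> for the reversed part. The subtraction is real, so
    \<open>\<theta> = 0\<close> also gives \<open>M = 1\<close>.\<close>
  define M where "M = max (real \<theta> - 1) 1"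
  have M: "1 \<le> M" by (simp add: M_def)
  have "card {u \<in> verts G. d i u < 0} \<le> \<theta>" if "i \<in> {1..k}" for i
    unfolding assms(5) using that by (intro Max_ge) auto
  then have card: "real (card {u \<in> verts G. d i u < 0}) - 1 \<le> M" if "i \<in> {1..k}" for i
    using that by (force simp: M_def)
  let ?X = "flow_value G k (\<lambda>i. with_sink G (d i) (w i))"
  \<comment> \<open>The product form reduces the claim to single sink choices and values
    \<open>r\<close>, also when \<open>?X\<close> is infinite; the division comes last.\<close>
  have "ereal r \<le> ereal M * ?X"
    if v: "v \<in> {1..k} \<rightarrow>\<^sub>E verts G" and r: "feasible_value G k (\<lambda>i. with_sink G (d i) (v i)) r" for v r
  proof -
    have "v i \<in> verts G" if "i \<in> {1..k}" for i
      using v that by (rule PiE_mem)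
    then have "feasible_value G k (\<lambda>i. with_sink G (d i) (w i)) (r / M)"
      by (rule feasible_value_reroute[OF r _ assms(3,4) M card])
    then have "ereal (r / M) \<le> ?X"
      unfolding flow_value_def by (intro SUP_upper) simp
    then have "ereal M * ereal (r / M) \<le> ereal M * ?X"
      using M by (intro ereal_mult_left_mono) auto
    then show ?thesis using M by simp
  qed
  then have "lomuf_value G k d \<le> ereal M * ?X"
    unfolding lomuf_value_def flow_value_def[of _ _ "\<lambda>i. with_sink G (d i) (_ i)"]
    by (intro SUP_least) auto
  then show ?thesis
    unfolding M_def[symmetric] using M by (subst ereal_divide_le_pos) auto
qed

end
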